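(* Let $M$ be a finite set of prime numbers and let $p_j\in M$. Then $$f_M\!\left(\frac{\prod_{p_i\in M}p_i}{p_j-1}\right) = f_{M\setminus\{p_j\}}\!\left(\prod_{p_i\in M\setminus\{p_j\}}p_i\right).$$
   Context: For a finite set $S$ of primes and a real number $x\ge 0$, $f_S(x)$ denotes the number of positive integers $\le x$ that are not divisible by any prime in $S$. An empty product equals $1$. *)

theory Defs
  imports Complex_Main "HOL-Computational_Algebra.Primes"
begin

definition sifted_count :: "nat set \<Rightarrow> real \<Rightarrow> nat" where
  "sifted_count S x = card {n :: nat. 0 < n \<and> real n \<le> x \<and> (\<forall>p\<in>S. \<not> p dvd n)}"

end

(* Let P be the product of the primes in M - {q}. With y = P / (q - 1), the argument on the
   left is P + y, and also q y. Splitting the (M - {q})-sifted integers up to q y by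
   divisibility by q, and up to P + y by whether they exceed P (sifting is P-periodic), gives
   f_M(q y) + f_(M - {q})(y) = f_(M - {q})(q y) = f_(M - {q})(P) + f_(M - {q})(y). *)
theory Submission
  imports Defs
begin

lemma finite_sifted: "finite {n :: nat. 0 < n \<and> real n \<le> x \<and> Q n}"
  by (rule finite_subset[of _ "{..nat \<lfloor>x\<rfloor>}"]) (auto simp: le_nat_floor)

text \<open>The integers lost on sifting by \<open>q\<close> as well are the multiples
  \<open>q * m\<close>. Dividing by \<open>q\<close> matches them with the \<open>S\<close>-sifted
  \<open>m\<close> up to \<open>y\<close>, as \<open>q\<close> is coprime to every prime in
  \<open>S\<close>.\<close>

lemma sifted_count_insert_prime:
  assumes "prime q" and "q \<notin> S" and "\<And>p. p \<in> S \<Longrightarrow> prime p"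
  shows "sifted_count (insert q S) (real q * y) + sifted_count S y = sifted_count S (real q * y)"
proof -
  let ?F = "\<lambda>S x. {n :: nat. 0 < n \<and> real n \<le> x \<and> (\<forall>p\<in>S. \<not> p dvd n)}"
  have q0: "q > 0"
    using assms(1) by (simp add: prime_gt_0_nat)
  \<comment> \<open>If \<open>p\<close> divided \<open>q\<close>, both being prime, then
    \<open>p = q\<close>, against \<open>q \<notin> S\<close>.\<close>
  have dvd_iff: "p dvd q * m \<longleftrightarrow> p dvd m" if "p \<in> S" for p m
    using assms that by (metis dvd_mult prime_dvd_mult_nat primes_dvd_imp_eq)
  have union: "?F S (real q * y) = ?F (insert q S) (real q * y) \<union> (*) q ` ?F S y"
    (is "?L = ?A \<union> ?B")
  proof (rule set_eqI)
    fix n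
    show "n \<in> ?L \<longleftrightarrow> n \<in> ?A \<union> ?B"
    proof (cases "q dvd n")
      case True
      then obtain m where n: "n = q * m" ..
      show ?thesis
        using q0 by (auto simp: n dvd_iff)
    qed auto
  qed
  have "card (?A \<union> ?B) = card ?A + card ?B"
    by (rule card_Un_disjoint) (auto intro: finite_sifted finite_imageI)
  moreover have "card ?B = card (?F S y)"
    using q0 by (intro card_image inj_onI) auto
  ultimately show ?thesis
    unfolding sifted_count_def union by simp
qed

text \<open>Translation by \<open>P\<close> preserves divisibility by each \<open>p\<close> in
  \<open>S\<close>, so the sifted integers beyond \<open>P\<close> are the translates of those up to
  \<open>y\<close>.\<close>

lemma sifted_count_add_period:
  assumes "\<And>p. p \<in> S \<Longrightarrow> p dvd P" and "y \<ge> 0"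
  shows "sifted_count S (real P + y) = sifted_count S (real P) + sifted_count S y"
proof -
  let ?F = "\<lambda>x. {n :: nat. 0 < n \<and> real n \<le> x \<and> (\<forall>p\<in>S. \<not> p dvd n)}"
  have dvd_iff: "p dvd P + m \<longleftrightarrow> p dvd m" if "p \<in> S" for p m
    using assms(1)[OF that] by (simp add: dvd_add_right_iff)
  have union: "?F (real P + y) = ?F (real P) \<union> (+) P ` ?F y"
    (is "?L = ?A \<union> ?B")
  proof (rule set_eqI)
    fix n
    show "n \<in> ?L \<longleftrightarrow> n \<in> ?A \<union> ?B"
    proof (cases "n \<le> P")
      \<comment> \<open>Here \<open>y \<ge> 0\<close> keeps \<open>n\<close> within the bound
        \<open>P + y\<close>, while translates of positive integers exceed \<open>P\<close>.\<close>
      case True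
      then show ?thesis
        using assms(2) by auto
    next
      case False
      then obtain m where n: "n = P + m" and "m > 0"
        by (metis less_imp_add_positive not_le)
      then show ?thesis
        by (auto simp: dvd_iff)
    qed
  qed
  have "card (?A \<union> ?B) = card ?A + card ?B"
    by (rule card_Un_disjoint) (auto intro: finite_sifted finite_imageI)
  moreover have "card ?B = card (?F y)"
    by (intro card_image inj_onI) auto
  ultimately show ?thesis
    unfolding sifted_count_def union by simp
qed

theorem mainTheorem13:
  fixes M :: "nat set" and q :: nat
  assumes "finite M"
    and "\<And>p. p \<in> M \<Longrightarrow> prime p"
    and "q \<in> M"
  shows "sifted_count M (real (\<Prod>p\<in>M. p) / (real q - 1))
       = sifted_count (M - {q}) (real (\<Prod>p\<in>M - {q}. p))"
proof -
  define P where "P = (\<Prod>p\<in>M - {q}. p)"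
  define y where "y = real P / (real q - 1)"
  have q: "prime q" "real q > 1"
    using assms(2,3) prime_gt_1_nat by auto
  have prod: "(\<Prod>p\<in>M. p) = q * P"
    unfolding P_def using assms(1,3) by (rule prod.remove)
  \<comment> \<open>The choice of \<open>y\<close> means \<open>(q - 1) * y = P\<close>, with
    \<open>q - 1\<close> positive; this lets both counting lemmas apply at the same point.\<close>
  have y: "y \<ge> 0" "real q * y = real P + y"
    using q(2) by (auto simp: y_def field_simps)
  have "sifted_count M (real q * y) + sifted_count (M - {q}) y
      = sifted_count (M - {q}) (real q * y)"
    using sifted_count_insert_prime[OF q(1), of "M - {q}" y] assms(2,3)
    by (simp add: insert_absorb)
  also have "\<dots> = sifted_count (M - {q}) (real P) + sifted_count (M - {q}) y"
    unfolding y(2) using assms(1) y(1)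
    by (intro sifted_count_add_period) (auto simp: P_def intro: dvd_prodI)
  finally have "sifted_count M (real q * y) = sifted_count (M - {q}) (real P)"
    by simp
  then show ?thesis
    by (simp add: prod y_def flip: P_def)
qed

end
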